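(* There is a modal sentence $\mathrm{Scatt}$ of $\mathcal L^{\Diamond}_{\le}$ such that for every nonempty linear order $L$, regarded as a world of $\mathrm{LO}^{\mathrm{cond}}$, $L\models\mathrm{Scatt}$ if and only if $L$ is scattered.
   Context: $\mathcal L_{\le}=\{\le\}$ and $\mathcal L^{\Diamond}_{\le}$ is its extension by modal operators $\Diamond,\Box$. A condensation is a surjective monotone map between nonempty linear orders; $\mathrm{LO}^{\mathrm{cond}}$ is the category of nonempty linear orders and condensations. Modal satisfaction: $U\models\Diamond\varphi[\nu]$ iff there is a condensation $f:U\to V$ with $V\models\varphi[f\circ\nu]$; $\Box$ dually. A linear order is scattered if it contains no copy of $(\mathbb Q,\le)$. *)

theory Defs
  imports Complex_Main
begin

datatype fm =
    Leq nat nat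
  | Eq nat nat
  | Neg fm
  | And fm fm
  | Or fm fm
  | Imp fm fm
  | Ex nat fm
  | All nat fm
  | Dia fm
  | Box fm

primrec free_vars :: "fm \<Rightarrow> nat set" where
  "free_vars (Leq i j) = {i, j}"
| "free_vars (Eq i j) = {i, j}"
| "free_vars (Neg p) = free_vars p"
| "free_vars (And p q) = free_vars p \<union> free_vars q"
| "free_vars (Or p q) = free_vars p \<union> free_vars q"
| "free_vars (Imp p q) = free_vars p \<union> free_vars q"
| "free_vars (Ex i p) = free_vars p - {i}"
| "free_vars (All i p) = free_vars p - {i}"
| "free_vars (Dia p) = free_vars p"
| "free_vars (Box p) = free_vars p"

definition sentence :: "fm \<Rightarrow> bool" where
  "sentence p \<longleftrightarrow> free_vars p = {}"

definition LO :: "'a set \<Rightarrow> 'a rel \<Rightarrow> bool" where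
  "LO A r \<longleftrightarrow> A \<noteq> {} \<and> linear_order_on A r"

definition condensation ::
    "'a set \<Rightarrow> 'a rel \<Rightarrow> 'b set \<Rightarrow> 'b rel \<Rightarrow> ('a \<Rightarrow> 'b) \<Rightarrow> bool" where
  "condensation A r B s f \<longleftrightarrow>
     LO A r \<and> LO B s \<and> f ` A = B \<and> (\<forall>x\<in>A. \<forall>y\<in>A. (x, y) \<in> r \<longrightarrow> (f x, f y) \<in> s)"

text \<open>
  The modal clauses quantify over targets whose carrier is a subset of the type of the
  source. As condensations are surjective, every condensation of \<open>(A, r)\<close> has an isomorphic
  copy of its target on such a subset (a system of representatives of the fibres), so no
  target is lost: see \<open>sat_DiaI_any_type\<close> and \<open>sat_BoxD_any_type\<close> below, where the
  target lives on an arbitrary type.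
\<close>

primrec sat :: "fm \<Rightarrow> 'a set \<Rightarrow> 'a rel \<Rightarrow> (nat \<Rightarrow> 'a) \<Rightarrow> bool" where
  "sat (Leq i j) A r v \<longleftrightarrow> (v i, v j) \<in> r"
| "sat (Eq i j) A r v \<longleftrightarrow> v i = v j"
| "sat (Neg p) A r v \<longleftrightarrow> \<not> sat p A r v"
| "sat (And p q) A r v \<longleftrightarrow> sat p A r v \<and> sat q A r v"
| "sat (Or p q) A r v \<longleftrightarrow> sat p A r v \<or> sat q A r v"
| "sat (Imp p q) A r v \<longleftrightarrow> (sat p A r v \<longrightarrow> sat q A r v)"
| "sat (Ex i p) A r v \<longleftrightarrow> (\<exists>a\<in>A. sat p A r (v(i := a)))"
| "sat (All i p) A r v \<longleftrightarrow> (\<forall>a\<in>A. sat p A r (v(i := a)))"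
| "sat (Dia p) A r v \<longleftrightarrow>
     (\<exists>(B :: 'a set) s f. condensation A r B s f \<and> sat p B s (f \<circ> v))"
| "sat (Box p) A r v \<longleftrightarrow>
     (\<forall>(B :: 'a set) s f. condensation A r B s f \<longrightarrow> sat p B s (f \<circ> v))"

definition models :: "'a set \<Rightarrow> 'a rel \<Rightarrow> fm \<Rightarrow> bool" where
  "models A r p \<longleftrightarrow> (\<forall>v. range v \<subseteq> A \<longrightarrow> sat p A r v)"

definition scattered :: "'a set \<Rightarrow> 'a rel \<Rightarrow> bool" where
  "scattered A r \<longleftrightarrow>
     \<not> (\<exists>g :: rat \<Rightarrow> 'a. range g \<subseteq> A \<and> (\<forall>p q. p \<le> q \<longleftrightarrow> (g p, g q) \<in> r))"

definition Lt :: "nat \<Rightarrow> nat \<Rightarrow> fm" where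
  "Lt i j = And (Leq i j) (Neg (Eq i j))"

text \<open>
  No condensation has a dense target with at least two points. The sentence is
  named, rather than bound by an existential quantifier in the theorem, because a bound
  witness could depend on the type variable for the elements of the orders; a constant of
  type \<open>fm\<close> is one and the same sentence for linear orders on all types.
\<close>

definition Scatt :: fm where
  "Scatt =
     Box (Neg (And (Ex 0 (Ex 1 (Lt 0 1)))
                   (All 0 (All 1 (Imp (Lt 0 1) (Ex 2 (And (Lt 0 2) (Lt 2 1))))))))"

subsection \<open>Independence of the type carrying the targets\<close>

definition order_iso ::
    "'a set \<Rightarrow> 'a rel \<Rightarrow> 'b set \<Rightarrow> 'b rel \<Rightarrow> ('a \<Rightarrow> 'b) \<Rightarrow> bool" where
  "order_iso A r B s h \<longleftrightarrow> LO A r \<and> LO B s \<and> bij_betw h A B \<and>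
     (\<forall>x\<in>A. \<forall>y\<in>A. (x, y) \<in> r \<longleftrightarrow> (h x, h y) \<in> s)"

lemma order_iso_inv:
  assumes "order_iso A r B s h"
  shows "order_iso B s A r (inv_into A h)"
proof -
  have b: "bij_betw h A B" using assms by (simp add: order_iso_def)
  have "\<And>x. x \<in> B \<Longrightarrow> inv_into A h x \<in> A \<and> h (inv_into A h x) = x"
    using b by (metis bij_betw_def f_inv_into_f inv_into_into)
  then show ?thesis
    using assms bij_betw_inv_into[OF b] by (simp add: order_iso_def)
qed

lemma order_iso_condensation: "order_iso A r B s h \<Longrightarrow> condensation A r B s h"
  by (auto simp: order_iso_def condensation_def bij_betw_def)

lemma condensation_comp:
  "condensation A r B s f \<Longrightarrow> condensation B s C t g \<Longrightarrow> condensation A r C t (g \<circ> f)"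
  by (auto simp: condensation_def)

lemma order_iso_image:
  assumes C: "LO C t" and j: "inj_on j C"
  shows "order_iso C t (j ` C) ((\<lambda>(x, y). (j x, j y)) ` t) j"
proof -
  let ?u = "(\<lambda>(x, y). (j x, j y)) ` t"
  have tC: "t \<subseteq> C \<times> C"
    using C by (auto simp: LO_def order_on_defs)
  have iff: "(j x, j y) \<in> ?u \<longleftrightarrow> (x, y) \<in> t" if "x \<in> C" "y \<in> C" for x y
  proof
    assume "(j x, j y) \<in> ?u"
    then obtain a b where "(a, b) \<in> t" "j x = j a" "j y = j b" by auto
    moreover then have "a \<in> C" "b \<in> C" using tC by auto
    ultimately show "(x, y) \<in> t" using that j by (metis inj_onD)
  qed force
  have "?u \<subseteq> j ` C \<times> j ` C" using tC by auto
  moreover have "refl_on (j ` C) ?u"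
    using C iff by (auto simp: LO_def order_on_defs refl_on_def)
  moreover have "trans ?u"
  proof (rule transI)
    fix x y z assume a: "(x, y) \<in> ?u" "(y, z) \<in> ?u"
    then have "x \<in> j ` C" "y \<in> j ` C" "z \<in> j ` C" using tC by auto
    then obtain a b c where "x = j a" "y = j b" "z = j c" "a \<in> C" "b \<in> C" "c \<in> C"
      by blast
    moreover have "trans t" using C by (auto simp: LO_def order_on_defs)
    ultimately show "(x, z) \<in> ?u" using a iff by (meson transD)
  qed
  moreover have "antisym ?u"
  proof (rule antisymI)
    fix x y assume a: "(x, y) \<in> ?u" "(y, x) \<in> ?u"
    then have "x \<in> j ` C" "y \<in> j ` C" using tC by auto
    then obtain a b where "x = j a" "y = j b" "a \<in> C" "b \<in> C"
      by blast
    moreover have "antisym t" using C by (auto simp: LO_def order_on_defs)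
    ultimately show "x = y" using a iff by (metis antisymD)
  qed
  moreover have "total_on (j ` C) ?u"
    unfolding total_on_def
  proof (intro ballI impI)
    fix x y assume "x \<in> j ` C" "y \<in> j ` C" "x \<noteq> y"
    then obtain a b where "x = j a" "y = j b" "a \<in> C" "b \<in> C" "a \<noteq> b" by auto
    moreover have "total_on C t" using C by (auto simp: LO_def order_on_defs)
    ultimately show "(x, y) \<in> ?u \<or> (y, x) \<in> ?u" using iff by (auto simp: total_on_def)
  qed
  ultimately have "LO (j ` C) ?u" using C by (auto simp: LO_def order_on_defs)
  then show ?thesis using C j iff by (auto simp: order_iso_def bij_betw_def)
qed

lemma condensation_transport:
  assumes "condensation (B :: 'b set) s (C :: 'a set) t f"
  obtains D u j where "order_iso C t (D :: 'b set) u j"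
proof -
  have f: "f ` B = C" and C: "LO C t" using assms by (auto simp: condensation_def)
  have "inj_on (inv_into B f) C" using f by (simp add: inj_on_inv_into)
  from that[OF order_iso_image[OF C this]] show ?thesis .
qed

lemma sat_iso_aux:
  assumes IH: "\<And>(A :: 'a set) r (B :: 'b set) s h v.
      order_iso A r B s h \<Longrightarrow> range v \<subseteq> A \<Longrightarrow> sat p A r v \<longleftrightarrow> sat p B s (h \<circ> v)"
    and h: "order_iso (A :: 'a set) r (B :: 'b set) s h" and v: "range v \<subseteq> A"
  shows "(\<exists>(C :: 'a set) t f. condensation A r C t f \<and> sat p C t (f \<circ> v) = P) \<longleftrightarrow>
         (\<exists>(D :: 'b set) u g. condensation B s D u g \<and> sat p D u (g \<circ> (h \<circ> v)) = P)"
proof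
  let ?k = "inv_into A h"
  have kh: "?k (h x) = x" if "x \<in> A" for x
    using h that by (auto simp: order_iso_def bij_betw_def)
  assume "\<exists>(C :: 'a set) t f. condensation A r C t f \<and> sat p C t (f \<circ> v) = P"
  then obtain C t f where f: "condensation A r (C :: 'a set) t f" and P: "sat p C t (f \<circ> v) = P"
    by blast
  have fk: "condensation B s C t (f \<circ> ?k)"
    using condensation_comp[OF order_iso_condensation[OF order_iso_inv[OF h]] f] .
  obtain D u j where j: "order_iso C t (D :: 'b set) u j"
    using condensation_transport[OF fk] .
  have c: "condensation B s D u (j \<circ> (f \<circ> ?k))"
    using condensation_comp[OF fk order_iso_condensation[OF j]] .
  have "range (f \<circ> v) \<subseteq> C" using f v by (auto simp: condensation_def)
  then have "sat p D u (j \<circ> (f \<circ> v)) = P" using IH[OF j] P by blast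
  moreover have "(j \<circ> (f \<circ> ?k)) \<circ> (h \<circ> v) = j \<circ> (f \<circ> v)"
    using kh v by (simp add: fun_eq_iff image_subset_iff)
  ultimately show "\<exists>(D :: 'b set) u g. condensation B s D u g \<and> sat p D u (g \<circ> (h \<circ> v)) = P"
    using c by metis
next
  assume "\<exists>(D :: 'b set) u g. condensation B s D u g \<and> sat p D u (g \<circ> (h \<circ> v)) = P"
  then obtain D u g where g: "condensation B s (D :: 'b set) u g"
    and P: "sat p D u (g \<circ> (h \<circ> v)) = P" by blast
  have gh: "condensation A r D u (g \<circ> h)"
    using condensation_comp[OF order_iso_condensation[OF h] g] .
  obtain C t j where j: "order_iso D u (C :: 'a set) t j"
    using condensation_transport[OF gh] .
  let ?i = "inv_into D j"
  have c: "condensation A r C t (j \<circ> (g \<circ> h))"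
    using condensation_comp[OF gh order_iso_condensation[OF j]] .
  have "range ((j \<circ> (g \<circ> h)) \<circ> v) \<subseteq> C" using c v by (auto simp: condensation_def)
  then have "sat p C t ((j \<circ> (g \<circ> h)) \<circ> v) \<longleftrightarrow> sat p D u (?i \<circ> ((j \<circ> (g \<circ> h)) \<circ> v))"
    using IH[OF order_iso_inv[OF j]] by blast
  moreover have "?i \<circ> ((j \<circ> (g \<circ> h)) \<circ> v) = g \<circ> (h \<circ> v)"
  proof
    fix n
    have "g (h (v n)) \<in> D" using gh v by (auto simp: condensation_def)
    then show "(?i \<circ> ((j \<circ> (g \<circ> h)) \<circ> v)) n = (g \<circ> (h \<circ> v)) n"
      using j by (auto simp: order_iso_def bij_betw_def)
  qed
  ultimately have "sat p C t ((j \<circ> (g \<circ> h)) \<circ> v) = P" using P by simp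
  then show "\<exists>(C :: 'a set) t f. condensation A r C t f \<and> sat p C t (f \<circ> v) = P"
    using c by blast
qed

lemma sat_iso:
  assumes "order_iso (A :: 'a set) r (B :: 'b set) s h" and "range v \<subseteq> A"
  shows "sat p A r v \<longleftrightarrow> sat p B s (h \<circ> v)"
  using assms
proof (induction p arbitrary: A r B s h v)
  case (Leq i j)
  then show ?case by (simp add: order_iso_def image_subset_iff)
next
  case (Eq i j)
  then show ?case by (auto simp: order_iso_def bij_betw_def inj_on_def image_subset_iff)
next
  case (Ex i p)
  have B: "B = h ` A" using Ex.prems by (auto simp: order_iso_def bij_betw_def)
  have "sat p A r (v(i := a)) \<longleftrightarrow> sat p B s ((h \<circ> v)(i := h a))" if "a \<in> A" for a
  proof -
    have "range (v(i := a)) \<subseteq> A" using Ex.prems(2) that by auto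
    then show ?thesis using Ex.IH[OF Ex.prems(1)] by (simp only: fun_upd_comp)
  qed
  then show ?case unfolding sat.simps using B by blast
next
  case (All i p)
  have B: "B = h ` A" using All.prems by (auto simp: order_iso_def bij_betw_def)
  have "sat p A r (v(i := a)) \<longleftrightarrow> sat p B s ((h \<circ> v)(i := h a))" if "a \<in> A" for a
  proof -
    have "range (v(i := a)) \<subseteq> A" using All.prems(2) that by auto
    then show ?thesis using All.IH[OF All.prems(1)] by (simp only: fun_upd_comp)
  qed
  then show ?case unfolding sat.simps using B by blast
next
  case (Dia p)
  show ?case using sat_iso_aux[OF Dia.IH Dia.prems, of True] unfolding sat.simps by blast
next
  case (Box p)
  show ?case using sat_iso_aux[OF Box.IH Box.prems, of False] unfolding sat.simps by blast
next
  case (Neg p)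
  show ?case using Neg.IH[OF Neg.prems] by simp
next
  case (And p q)
  show ?case using And.IH(1)[OF And.prems] And.IH(2)[OF And.prems] by simp
next
  case (Or p q)
  show ?case using Or.IH(1)[OF Or.prems] Or.IH(2)[OF Or.prems] by simp
next
  case (Imp p q)
  show ?case using Imp.IH(1)[OF Imp.prems] Imp.IH(2)[OF Imp.prems] by simp
qed

lemma condensation_any_type:
  assumes f: "condensation (A :: 'a set) r (B :: 'b set) s f" and v: "range v \<subseteq> A"
  obtains C t g where "condensation A r (C :: 'a set) t g"
    and "\<And>p. sat p C t (g \<circ> v) \<longleftrightarrow> sat p B s (f \<circ> v)"
proof -
  obtain C t j where j: "order_iso B s (C :: 'a set) t j"
    using condensation_transport[OF f] .
  have "range (f \<circ> v) \<subseteq> B" using f v by (auto simp: condensation_def)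
  then have "sat p C t ((j \<circ> f) \<circ> v) \<longleftrightarrow> sat p B s (f \<circ> v)" for p
    using sat_iso[OF j] by (simp add: comp_assoc)
  then show ?thesis
    using that condensation_comp[OF f order_iso_condensation[OF j]] by blast
qed

lemma sat_DiaI_any_type:
  fixes A :: "'a set" and B :: "'b set"
  assumes "condensation A r B s f" and "range v \<subseteq> A" and "sat p B s (f \<circ> v)"
  shows "sat (Dia p) A r v"
  using condensation_any_type[OF assms(1,2)] assms(3) by (metis sat.simps(9))

lemma sat_BoxD_any_type:
  fixes A :: "'a set" and B :: "'b set"
  assumes "sat (Box p) A r v" and "condensation A r B s f" and "range v \<subseteq> A"
  shows "sat p B s (f \<circ> v)"
  using condensation_any_type[OF assms(2,3)] assms(1) by (metis sat.simps(10))

end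

theory Submission
  imports Defs "HOL-Library.Countable"
begin

text \<open>
  A dense target with two points contains a copy of the rationals, by Cantor's construction along
  an enumeration, and choosing preimages lifts the copy to the source. Conversely, given a copy
  \<open>g\<close> of the rationals, send \<open>a\<close> to the real supremum of the rationals \<open>q\<close> in \<open>(0, 1)\<close> with
  \<open>g q \<le> a\<close>. The image lies in \<open>[0, 1]\<close> and contains every rational of \<open>(0, 1)\<close>, hence is dense.
  Real suprema are used rather than the sets of such \<open>q\<close> themselves, because the cuts \<open>{..<q}\<close> and
  \<open>{..q}\<close> may both occur and would be adjacent.
\<close>

text \<open>The two-point clause matters: every nonempty order condenses onto a single point, which
  satisfies the betweenness clause vacuously. Endpoints are allowed.\<close>

definition dense_LO :: "'a set \<Rightarrow> 'a rel \<Rightarrow> bool" where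
  "dense_LO A r \<longleftrightarrow> LO A r \<and> (\<exists>x\<in>A. \<exists>y\<in>A. (x, y) \<in> r \<and> x \<noteq> y) \<and>
     (\<forall>x\<in>A. \<forall>y\<in>A. (x, y) \<in> r \<and> x \<noteq> y \<longrightarrow>
        (\<exists>z\<in>A. (x, z) \<in> r \<and> x \<noteq> z \<and> (z, y) \<in> r \<and> z \<noteq> y))"

definition dense_fm :: fm where
  "dense_fm = And (Ex 0 (Ex 1 (Lt 0 1)))
     (All 0 (All 1 (Imp (Lt 0 1) (Ex 2 (And (Lt 0 2) (Lt 2 1))))))"

lemma Scatt_eq: "Scatt = Box (Neg dense_fm)"
  by (simp add: Scatt_def dense_fm_def)

lemma sat_dense_fm: "LO A r \<Longrightarrow> sat dense_fm A r v \<longleftrightarrow> dense_LO A r"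
  by (simp add: dense_fm_def Lt_def dense_LO_def conj_ac)

lemma LO_finite_has_greatest:
  assumes "LO A r" "finite X" "X \<noteq> {}" "X \<subseteq> A"
  shows "\<exists>m\<in>X. \<forall>x\<in>X. (x, m) \<in> r"
  using assms(2-4)
proof (induction X rule: finite_ne_induct)
  case (singleton x)
  then show ?case using assms(1) by (auto simp: LO_def order_on_defs refl_on_def)
next
  case (insert x F)
  then obtain m where m: "m \<in> F" "\<forall>y\<in>F. (y, m) \<in> r" by auto
  have "m \<in> A" "x \<in> A" using m insert.prems by auto
  moreover have "refl_on A r" "total_on A r" "trans r"
    using assms(1) by (auto simp: LO_def order_on_defs)
  ultimately have "(x, x) \<in> r" "(x, m) \<in> r \<or> (m, x) \<in> r"
    unfolding refl_on_def total_on_def by metis+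
  then show ?case using m transD[OF \<open>trans r\<close>] by (metis insert_iff)
qed

lemma LO_converse: "LO A r \<Longrightarrow> LO A (r\<inverse>)"
  by (simp add: LO_def)

text \<open>Density is applied once, between the greatest element of \<open>X\<close> and the least
  element of \<open>Y\<close>. This is the extension step of Cantor's construction.\<close>

lemma dense_LO_between_finite:
  assumes D: "dense_LO A r" and "finite X" "X \<noteq> {}" "X \<subseteq> A" "finite Y" "Y \<noteq> {}" "Y \<subseteq> A"
    and lt: "\<And>x y. x \<in> X \<Longrightarrow> y \<in> Y \<Longrightarrow> (x, y) \<in> r \<and> x \<noteq> y"
  shows "\<exists>c\<in>A. (\<forall>x\<in>X. (x, c) \<in> r \<and> x \<noteq> c) \<and> (\<forall>y\<in>Y. (c, y) \<in> r \<and> c \<noteq> y)"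
proof -
  have L: "LO A r" using D by (simp add: dense_LO_def)
  have tr: "trans r" and an: "antisym r" using L by (auto simp: LO_def order_on_defs)
  obtain m where m: "m \<in> X" "\<forall>x\<in>X. (x, m) \<in> r"
    using LO_finite_has_greatest[OF L assms(2-4)] by blast
  \<comment> \<open>A least element is a greatest one for the converse order.\<close>
  obtain n where n: "n \<in> Y" "\<forall>y\<in>Y. (n, y) \<in> r"
    using LO_finite_has_greatest[OF LO_converse[OF L] assms(5-7)] by auto
  have "m \<in> A" "n \<in> A" "(m, n) \<in> r" "m \<noteq> n"
    using m n lt \<open>X \<subseteq> A\<close> \<open>Y \<subseteq> A\<close> by auto
  then obtain c where c: "c \<in> A" "(m, c) \<in> r" "m \<noteq> c" "(c, n) \<in> r" "c \<noteq> n"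
    using D unfolding dense_LO_def by blast
  have "\<forall>x\<in>X. (x, c) \<in> r \<and> x \<noteq> c" using c m tr an by (metis antisymD transD)
  moreover have "\<forall>y\<in>Y. (c, y) \<in> r \<and> c \<noteq> y" using c n tr an by (metis antisymD transD)
  ultimately show ?thesis using c by blast
qed

text \<open>Only the forth half of back-and-forth: each element, in the order of its code, is sent
  into the gap left by the finitely many elements already placed. Surjectivity is not sought, so
  \<open>A\<close> may be uncountable.\<close>

lemma countable_embeds_dense_LO:
  assumes D: "dense_LO A r"
  shows "\<exists>g :: 'c :: {countable, linorder} \<Rightarrow> 'a.
    range g \<subseteq> A \<and> (\<forall>p q. p < q \<longrightarrow> (g p, g q) \<in> r \<and> g p \<noteq> g q)"
proof -
  define lt where "lt x y \<longleftrightarrow> (x, y) \<in> r \<and> x \<noteq> y" for x y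
  obtain a b where ab: "a \<in> A" "b \<in> A" "lt a b"
    using D by (auto simp: dense_LO_def lt_def)
  let ?R = "measure (to_nat :: 'c \<Rightarrow> nat)"
  \<comment> \<open>\<open>c\<close> is an admissible value at \<open>q\<close>, given the values of
    \<open>f\<close> at elements with smaller code. The fixed bounds \<open>a\<close> and
    \<open>b\<close> keep both sides of the gap nonempty, even when no earlier element lies
    there.\<close>
  define P where "P f q c \<longleftrightarrow> c \<in> A \<and> lt a c \<and> lt c b \<and>
      (\<forall>p. (p, q) \<in> ?R \<longrightarrow> (p < q \<longrightarrow> lt (f p) c) \<and> (q < p \<longrightarrow> lt c (f p)))"
    for f :: "'c \<Rightarrow> 'a" and q c
  have "\<exists>g. \<forall>q. P g q (g q)"
  proof (rule dependent_wf_choice)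
    show "wf ?R" by simp
  next
    fix f g :: "'c \<Rightarrow> 'a" and q c
    assume "\<And>p. (p, q) \<in> ?R \<Longrightarrow> f p = g p"
    then show "P f q c = P g q c" unfolding P_def by auto
  next
    fix q and f :: "'c \<Rightarrow> 'a"
    assume IH: "\<And>p. (p, q) \<in> ?R \<Longrightarrow> P f p (f p)"
    let ?X = "insert a (f ` {p. (p, q) \<in> ?R \<and> p < q})"
    let ?Y = "insert b (f ` {p. (p, q) \<in> ?R \<and> q < p})"
    have "finite (to_nat -` {..<to_nat q} :: 'c set)"
      by (rule finite_vimageI) auto
    moreover have "to_nat -` {..<to_nat q} = {p. (p, q) \<in> ?R}" by auto
    ultimately have "finite {p. (p, q) \<in> ?R}" by simp
    then have fin: "finite ?X" "finite ?Y" by auto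
    have sub: "?X \<subseteq> A" "?Y \<subseteq> A" using IH ab by (auto simp: P_def)
    \<comment> \<open>Whichever of \<open>p\<close> and \<open>p'\<close> has the larger code was
      placed on the correct side of the other.\<close>
    have mid: "lt (f p) (f p')"
      if "(p, q) \<in> ?R" "p < q" "(p', q) \<in> ?R" "q < p'" for p p'
    proof -
      have "p < p'" using that by simp
      then have "(p, p') \<in> ?R \<or> (p', p) \<in> ?R"
        using nat_neq_iff[of "to_nat p" "to_nat p'"] by force
      then show ?thesis
        using IH[OF that(1)] IH[OF that(3)] \<open>p < p'\<close> unfolding P_def by blast
    qed
    have "lt x y" if "x \<in> ?X" "y \<in> ?Y" for x y
      using that mid IH ab by (auto simp: P_def)
    then have "\<exists>c\<in>A. (\<forall>x\<in>?X. lt x c) \<and> (\<forall>y\<in>?Y. lt c y)"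
      using dense_LO_between_finite[OF D fin(1) _ sub(1) fin(2) _ sub(2)]
      unfolding lt_def by blast
    then show "\<exists>c. P f q c" unfolding P_def by auto
  qed
  then obtain g where g: "\<And>q. P g q (g q)" by blast
  have "lt (g p) (g q)" if "p < q" for p q
  proof -
    have "(p, q) \<in> ?R \<or> (q, p) \<in> ?R"
      using that nat_neq_iff[of "to_nat p" "to_nat q"] by force
    then show ?thesis
      using that g[of p] g[of q] unfolding P_def by blast
  qed
  moreover have "range g \<subseteq> A" using g by (auto simp: P_def)
  ultimately show ?thesis unfolding lt_def by blast
qed

lemma dense_condensation_imp_not_scattered:
  assumes f: "condensation A r B s f" and D: "dense_LO B s"
  shows "\<not> scattered A r"
proof -
  obtain h :: "rat \<Rightarrow> _" where hB: "range h \<subseteq> B"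
    and h: "\<And>p q. p < q \<Longrightarrow> (h p, h q) \<in> s \<and> h p \<noteq> h q"
    using countable_embeds_dense_LO[OF D] by blast
  define g where "g = inv_into A f \<circ> h"
  have img: "f ` A = B" and mono: "\<And>x y. x \<in> A \<Longrightarrow> y \<in> A \<Longrightarrow> (x, y) \<in> r \<Longrightarrow> (f x, f y) \<in> s"
    using f by (auto simp: condensation_def)
  have gA: "g p \<in> A" and fg: "f (g p) = h p" for p
  proof -
    have "h p \<in> f ` A" using hB img by auto
    then show "g p \<in> A" "f (g p) = h p"
      by (simp_all add: g_def inv_into_into f_inv_into_f)
  qed
  have "antisym s" "refl_on A r" "total_on A r"
    using f by (auto simp: condensation_def LO_def order_on_defs)
  \<comment> \<open>Otherwise monotonicity of \<open>f\<close> would give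
    \<open>(h q, h p) \<in> s\<close>, against strictness of \<open>h\<close>. Totality of
    \<open>r\<close> then orients the chosen preimages.\<close>
  have not_le: "(g q, g p) \<notin> r" if "p < q" for p q
    using h[OF that] mono[OF gA gA, of q p] \<open>antisym s\<close> by (auto simp: fg dest: antisymD)
  have "(g p, g q) \<in> r" if "p < q" for p q
  proof -
    have "g p \<noteq> g q" using h[OF that] fg by metis
    then show ?thesis
      using not_le[OF that] \<open>total_on A r\<close> gA by (auto simp: total_on_def)
  qed
  then have "p \<le> q \<longleftrightarrow> (g p, g q) \<in> r" for p q
    using not_le \<open>refl_on A r\<close> gA by (metis linorder_not_le order_le_less refl_onD)
  then show ?thesis using gA unfolding scattered_def by blast
qed

lemma LO_subset_linorder:
  fixes B :: "'b :: linorder set"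
  assumes "B \<noteq> {}"
  shows "LO B {(x, y) \<in> B \<times> B. x \<le> y}"
  using assms
  by (auto simp: LO_def order_on_defs refl_on_def total_on_def intro!: transI antisymI)

lemma not_scattered_imp_dense_condensation:
  assumes L: "LO A r" and "\<not> scattered A r"
  shows "\<exists>(B :: real set) s f. condensation A r B s f \<and> dense_LO B s"
proof -
  obtain g :: "rat \<Rightarrow> _" where gA: "range g \<subseteq> A"
    and g: "\<And>p q. p \<le> q \<longleftrightarrow> (g p, g q) \<in> r"
    using assms(2) by (auto simp: scattered_def)
  have "trans r" using L by (auto simp: LO_def order_on_defs)
  \<comment> \<open>Restricting to \<open>(0, 1)\<close> bounds the set, and the added
    \<open>0\<close> makes it nonempty for points below this part of the copy, so real suprema
    behave as expected.\<close>
  define S where "S a = insert 0 (real_of_rat ` {q. 0 < q \<and> q < 1 \<and> (g q, a) \<in> r})" for a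
  define f where "f a = Sup (S a)" for a
  define B where "B = f ` A"
  define s where "s = {(x, y) \<in> B \<times> B. x \<le> y}"
  have S01: "S a \<subseteq> {0..1}" for a by (auto simp: S_def)
  then have bdd: "bdd_above (S a)" for a
    by (meson bdd_above_Icc bdd_above_mono)
  have ne: "S a \<noteq> {}" for a by (simp add: S_def)
  have f0: "0 \<le> f a" for a
    unfolding f_def by (rule cSup_upper[OF _ bdd]) (simp add: S_def)
  have f1: "f a \<le> 1" for a
    unfolding f_def by (rule cSup_least[OF ne]) (use S01 in force)
  have mono: "f x \<le> f y" if "(x, y) \<in> r" for x y
    unfolding f_def
    by (rule cSup_subset_mono[OF ne bdd])
      (use that \<open>trans r\<close> in \<open>auto simp: S_def dest: transD\<close>)
  \<comment> \<open>Here the supremum is attained: \<open>of_rat q\<close> itself lies in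
    \<open>S (g q)\<close>.\<close>
  have fg: "f (g q) = of_rat q" if "0 < q" "q < 1" for q
    unfolding f_def
    by (rule cSup_eq_maximum) (use that in \<open>auto simp: S_def g[symmetric] of_rat_less_eq\<close>)
  have inB: "of_rat q \<in> B" if "0 < q" "q < 1" for q
    using fg[OF that] gA unfolding B_def by (metis image_eqI range_subsetD)
  have between: "\<exists>z\<in>B. x < z \<and> z < y" if "x \<in> B" "y \<in> B" "x < y" for x y
  proof -
    obtain q where q: "x < of_rat q" "of_rat q < y" using of_rat_dense[OF \<open>x < y\<close>] by blast
    \<comment> \<open>A rational strictly between two values in \<open>[0, 1]\<close> lies in
      \<open>(0, 1)\<close>, hence is itself a value of \<open>f\<close>.\<close>
    have "0 \<le> x" "y \<le> 1" using that f0 f1 by (auto simp: B_def)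
    then have "0 < real_of_rat q" "real_of_rat q < 1" using q by linarith+
    then show ?thesis using inB q by auto
  qed
  have LB: "LO B s"
    unfolding s_def by (rule LO_subset_linorder) (use L in \<open>auto simp: B_def LO_def\<close>)
  have "condensation A r B s f"
    using L LB mono by (auto simp: condensation_def B_def s_def)
  moreover have "dense_LO B s"
  proof -
    have "real_of_rat (1/3) \<in> B" "real_of_rat (1/2) \<in> B" by (rule inB; simp)+
    moreover have "real_of_rat (1/3) < real_of_rat (1/2)" by (simp add: of_rat_less)
    ultimately have "\<exists>x\<in>B. \<exists>y\<in>B. (x, y) \<in> s \<and> x \<noteq> y"
      unfolding s_def by (metis (no_types, lifting) case_prodI less_le mem_Collect_eq mem_Sigma_iff)
    moreover have "\<exists>z\<in>B. (x, z) \<in> s \<and> x \<noteq> z \<and> (z, y) \<in> s \<and> z \<noteq> y"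
      if "x \<in> B" "y \<in> B" "(x, y) \<in> s" "x \<noteq> y" for x y
    proof -
      have "x < y" using that by (simp add: s_def)
      then obtain z where "z \<in> B" "x < z" "z < y" using between \<open>x \<in> B\<close> \<open>y \<in> B\<close> by blast
      then show ?thesis using that(1,2) by (intro bexI[of _ z]) (simp_all add: s_def)
    qed
    ultimately show ?thesis using LB unfolding dense_LO_def by blast
  qed
  ultimately show ?thesis by blast
qed

theorem theorem5p1:
  shows "sentence Scatt \<and>
    (\<forall>(L :: 'a set) (r :: 'a rel). LO L r \<longrightarrow> (models L r Scatt \<longleftrightarrow> scattered L r))"
proof (intro conjI allI impI iffI)
  show "sentence Scatt" by (auto simp: sentence_def Scatt_def Lt_def)
next
  fix L :: "'a set" and r
  assume L: "LO L r" and M: "models L r Scatt"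
  \<comment> \<open>A constant valuation makes \<open>models\<close> yield an actual instance of
    \<open>sat\<close>.\<close>
  obtain a where "a \<in> L" using L by (auto simp: LO_def)
  then have v: "range (\<lambda>_ :: nat. a) \<subseteq> L" by auto
  show "scattered L r"
  proof (rule ccontr)
    assume "\<not> scattered L r"
    then obtain B :: "real set" and s f where f: "condensation L r B s f" and D: "dense_LO B s"
      using not_scattered_imp_dense_condensation[OF L] by blast
    have "sat Scatt L r (\<lambda>_. a)" using M v by (simp add: models_def)
    \<comment> \<open>The clause for \<open>Box\<close> speaks of targets on the type of
      \<open>L\<close>, whereas \<open>B\<close> consists of reals; isomorphism invariance bridges
      the gap.\<close>
    from sat_BoxD_any_type[OF this[unfolded Scatt_eq] f v] D show False
      by (simp add: sat_dense_fm dense_LO_def)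
  qed
next
  fix L :: "'a set" and r
  assume S: "scattered L r"
  have "\<not> sat dense_fm B s v" if "condensation L r B s f" for B :: "'a set" and s f v
  proof -
    have "LO B s" using that by (simp add: condensation_def)
    then show ?thesis
      using sat_dense_fm dense_condensation_imp_not_scattered[OF that] S by blast
  qed
  then show "models L r Scatt" by (auto simp: models_def Scatt_eq)
qed

end
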